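(* Let $M,K\in\mathbb{R}^{n\times n}$, $B_u\in\mathbb{R}^{n\times m}$, $C_p,C_v\in\mathbb{R}^{p\times n}$, let $f,g:\mathbb{C}\to\mathbb{C}$, and put $D(s)=f(s)M+g(s)K$ and $\Phi(s)=s^2M+sD(s)+K$. Define $$d(s)=1+s\,g(s),\qquad n(s)=s^2+s\,f(s),\qquad h(s)=\frac{n(s)}{d(s)}$$ (with $h$ defined where $d(s)\neq 0$). Let $G$, $G_p$, $G_v$ be the full, position-output and velocity-output transfer functions defined in the context. Let $\mathrm{i}\vartheta_1,\dots,\mathrm{i}\vartheta_K\in\mathrm{i}\mathbb{R}$ and $\mathrm{i}\zeta_1,\dots,\mathrm{i}\zeta_J\in\mathrm{i}\mathbb{R}$ be left and right quadrature nodes, with associated weights $\varphi_1^2,\dots,\varphi_K^2$ and $\varrho_1^2,\dots,\varrho_J^2$, where $\varphi_k,\varrho_j\in\mathbb{R}$. Suppose that for all $j=1,\dots,J$ and $k=1,\dots,K$ $$\zeta_j\neq 0,\quad d(\mathrm{i}\vartheta_k)\neq 0,\quad d(\mathrm{i}\zeta_j)\neq 0,\quad h(\mathrm{i}\vartheta_k)\neq h(\mathrm{i}\zeta_j),$$ and that the matrices $\Phi(\mathrm{i}\zeta_j)$ and $\Phi(\mathrm{i}\vartheta_k)$ are invertible. Let $\check R_p\in\mathbb{C}^{n\times mJ}$ and $\check L_v\in\mathbb{C}^{n\times pK}$ be the quadrature-based factors defined in the context, and define $$\mathbb{M}=\check L_v^{\mathsf H}M\check R_p,\quad \mathbb{K}=\check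 L_v^{\mathsf H}K\check R_p,\quad \mathbb{B}_u=\check L_v^{\mathsf H}B_u,\quad \mathbb{C}_p=C_p\check R_p,\quad \mathbb{C}_v=C_v\check R_p.$$ Then for all $k=1,\dots,K$ and $j=1,\dots,J$ the blocks of these matrices are $$\mathbb{M}_{[k,j]}=-\frac{\varphi_k\varrho_j}{d(\mathrm{i}\vartheta_k)d(\mathrm{i}\zeta_j)}\;\frac{d(\mathrm{i}\vartheta_k)G(\mathrm{i}\vartheta_k)-d(\mathrm{i}\zeta_j)\left(G_p(\mathrm{i}\zeta_j)+\frac{\vartheta_k}{\zeta_j}G_v(\mathrm{i}\zeta_j)\right)}{h(\mathrm{i}\vartheta_k)-h(\mathrm{i}\zeta_j)},$$ $$\mathbb{K}_{[k,j]}=\frac{\varphi_k\varrho_j}{d(\mathrm{i}\vartheta_k)d(\mathrm{i}\zeta_j)}\;\frac{n(\mathrm{i}\vartheta_k)G(\mathrm{i}\vartheta_k)-n(\mathrm{i}\zeta_j)\left(G_p(\mathrm{i}\zeta_j)+\frac{\vartheta_k}{\zeta_j}G_v(\mathrm{i}\zeta_j)\right)}{h(\mathrm{i}\vartheta_k)-h(\mathrm{i}\zeta_j)},$$ $$(\mathbb{B}_u)_{[k,:]}=\varphi_k G(\mathrm{i}\vartheta_k),\qquad (\mathbb{C}_p)_{[:,j]}=\varrho_j G_p(\mathrm{i}\zeta_j),\qquad (\mathbb{C}_v)_{[:,j]}=\frac{\varrho_j}{\mathrm{i}\zeta_j}G_v(\mathrm{i}\zeta_j).$$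
   Context: Here $\mathrm{i}$ is the imaginary unit and $(\cdot)^{\mathsf H}$ is the conjugate transpose. The symbol $K$ denotes the stiffness matrix and, as an index bound, the number of left quadrature nodes; the symbol $n$ denotes the state dimension and, when written $n(s)$, the scalar function above. Transfer functions: wherever $\Phi(s)$ is invertible, $$G(s)=(C_p+sC_v)\Phi(s)^{-1}B_u,\qquad G_p(s)=C_p\Phi(s)^{-1}B_u,\qquad G_v(s)=s\,C_v\Phi(s)^{-1}B_u .$$ Quadrature-based factors: $$\check R_p=\begin{bmatrix}\varrho_1\Phi(\mathrm{i}\zeta_1)^{-1}B_u&\cdots&\varrho_J\Phi(\mathrm{i}\zeta_J)^{-1}B_u\end{bmatrix}\in\mathbb{C}^{n\times mJ},$$ $$\check L_v^{\mathsf H}=\begin{bmatrix}\varphi_1(C_p+\mathrm{i}\vartheta_1C_v)\Phi(\mathrm{i}\vartheta_1)^{-1}\\ \vdots\\ \varphi_K(C_p+\mathrm{i}\vartheta_KC_v)\Phi(\mathrm{i}\vartheta_K)^{-1}\end{bmatrix}\in\mathbb{C}^{pK\times n}.$$ Block notation: for $X\in\mathbb{C}^{pK\times mJ}$, $X_{[k,j]}\in\mathbb{C}^{p\times m}$ is the submatrix with rows $(k-1)p+1,\dots,kp$ and columns $(j-1)m+1,\dots,jm$. For $X\in\mathbb{C}^{pK\times m}$, $X_{[k,:]}$ is the $k$-th block of $p$ rows; for $X\in\mathbb{C}^{p\times mJ}$, $X_{[:,j]}$ is the $j$-th block of $m$ columns. *)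

theory Defs
  imports
    Complex_Main
    "Jordan_Normal_Form.Matrix"
    "Jordan_Normal_Form.Schur_Decomposition"
    "Jordan_Normal_Form.Gauss_Jordan_Elimination"
    "Jordan_Normal_Form.DL_Submatrix"
begin

abbreviation cmat :: "real mat \<Rightarrow> complex mat" where
  "cmat \<equiv> map_mat complex_of_real"

(* Unspecified unless A is an invertible square matrix. *)
definition mat_inv :: "complex mat \<Rightarrow> complex mat" where
  "mat_inv A = the (mat_inverse A)"

definition damping_mat ::
  "(complex \<Rightarrow> complex) \<Rightarrow> (complex \<Rightarrow> complex) \<Rightarrow> real mat \<Rightarrow> real mat \<Rightarrow> complex \<Rightarrow> complex mat" where
  "damping_mat f g M K s = f s \<cdot>\<^sub>m cmat M + g s \<cdot>\<^sub>m cmat K"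

definition Phi_mat ::
  "(complex \<Rightarrow> complex) \<Rightarrow> (complex \<Rightarrow> complex) \<Rightarrow> real mat \<Rightarrow> real mat \<Rightarrow> complex \<Rightarrow> complex mat" where
  "Phi_mat f g M K s = s\<^sup>2 \<cdot>\<^sub>m cmat M + s \<cdot>\<^sub>m damping_mat f g M K s + cmat K"

definition d_fun :: "(complex \<Rightarrow> complex) \<Rightarrow> complex \<Rightarrow> complex" where
  "d_fun g s = 1 + s * g s"

definition n_fun :: "(complex \<Rightarrow> complex) \<Rightarrow> complex \<Rightarrow> complex" where
  "n_fun f s = s\<^sup>2 + s * f s"

definition h_fun :: "(complex \<Rightarrow> complex) \<Rightarrow> (complex \<Rightarrow> complex) \<Rightarrow> complex \<Rightarrow> complex" where
  "h_fun f g s = n_fun f s / d_fun g s"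

(* In the transfer functions and the quadrature factors, \<Phi> is a matrix-valued function of s. *)

definition transfer_fun ::
  "(complex \<Rightarrow> complex mat) \<Rightarrow> real mat \<Rightarrow> real mat \<Rightarrow> real mat \<Rightarrow> complex \<Rightarrow> complex mat" where
  "transfer_fun \<Phi> Bu Cp Cv s = (cmat Cp + s \<cdot>\<^sub>m cmat Cv) * mat_inv (\<Phi> s) * cmat Bu"

definition transfer_pos ::
  "(complex \<Rightarrow> complex mat) \<Rightarrow> real mat \<Rightarrow> real mat \<Rightarrow> complex \<Rightarrow> complex mat" where
  "transfer_pos \<Phi> Bu Cp s = cmat Cp * mat_inv (\<Phi> s) * cmat Bu"

definition transfer_vel ::
  "(complex \<Rightarrow> complex mat) \<Rightarrow> real mat \<Rightarrow> real mat \<Rightarrow> complex \<Rightarrow> complex mat" where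
  "transfer_vel \<Phi> Bu Cv s = s \<cdot>\<^sub>m (cmat Cv * mat_inv (\<Phi> s) * cmat Bu)"

text \<open>Blocks and quadrature nodes are numbered from 0, as are matrix entries: block \<open>k\<close> of
  height \<open>p\<close> consists of the rows \<open>k * p, \<dots>, k * p + p - 1\<close>.\<close>

(* The matrix [A 0, ..., A (J - 1)], where each A j is n x m. *)
definition block_row :: "nat \<Rightarrow> nat \<Rightarrow> nat \<Rightarrow> (nat \<Rightarrow> 'a mat) \<Rightarrow> 'a mat" where
  "block_row n m J A = mat n (m * J) (\<lambda>(a, c). A (c div m) $$ (a, c mod m))"

(* The matrix with A 0, ..., A (N - 1) stacked from top to bottom, where each A k is p x n. *)
definition block_col :: "nat \<Rightarrow> nat \<Rightarrow> nat \<Rightarrow> (nat \<Rightarrow> 'a mat) \<Rightarrow> 'a mat" where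
  "block_col p n N A = mat (p * N) n (\<lambda>(r, b). A (r div p) $$ (r mod p, b))"

definition block :: "nat \<Rightarrow> nat \<Rightarrow> 'a mat \<Rightarrow> nat \<Rightarrow> nat \<Rightarrow> 'a mat" where
  "block p m X k j = submatrix X {k * p ..< (k + 1) * p} {j * m ..< (j + 1) * m}"

definition row_block :: "nat \<Rightarrow> 'a mat \<Rightarrow> nat \<Rightarrow> 'a mat" where
  "row_block p X k = submatrix X {k * p ..< (k + 1) * p} UNIV"

definition col_block :: "nat \<Rightarrow> 'a mat \<Rightarrow> nat \<Rightarrow> 'a mat" where
  "col_block m X j = submatrix X UNIV {j * m ..< (j + 1) * m}"

(* The nodes are \<i> * \<zeta> j and \<i> * \<theta> k; the quadrature weights are the squares of \<rho> j and \<phi> k. *)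

definition right_factor ::
  "(complex \<Rightarrow> complex mat) \<Rightarrow> real mat \<Rightarrow> nat \<Rightarrow> (nat \<Rightarrow> real) \<Rightarrow> (nat \<Rightarrow> real) \<Rightarrow> complex mat" where
  "right_factor \<Phi> Bu J \<rho> \<zeta> = block_row (dim_row Bu) (dim_col Bu) J
     (\<lambda>j. complex_of_real (\<rho> j) \<cdot>\<^sub>m (mat_inv (\<Phi> (\<i> * \<zeta> j)) * cmat Bu))"

(* Its conjugate transpose is the stacked matrix. *)
definition left_factor ::
  "(complex \<Rightarrow> complex mat) \<Rightarrow> real mat \<Rightarrow> real mat \<Rightarrow> nat \<Rightarrow> (nat \<Rightarrow> real) \<Rightarrow> (nat \<Rightarrow> real) \<Rightarrow> complex mat" where
  "left_factor \<Phi> Cp Cv N \<phi> \<theta> = mat_adjoint (block_col (dim_row Cp) (dim_col Cp) N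
     (\<lambda>k. complex_of_real (\<phi> k) \<cdot>\<^sub>m
        ((cmat Cp + (\<i> * \<theta> k) \<cdot>\<^sub>m cmat Cv) * mat_inv (\<Phi> (\<i> * \<theta> k)))))"

end

theory Submission
  imports Defs
begin

text \<open>Write \<open>\<Phi> s = n s M + d s K\<close>. For nodes \<open>s\<close>, \<open>t\<close> and \<open>C = C\<^sub>p + s C\<^sub>v\<close>, inserting
  \<open>\<Phi> t\<close> resp. \<open>\<Phi> s\<close> between the two inverses of \<open>P = C (\<Phi> s)\<inverse> M (\<Phi> t)\<inverse> B\<^sub>u\<close> and
  \<open>Q = C (\<Phi> s)\<inverse> K (\<Phi> t)\<inverse> B\<^sub>u\<close> gives the linear system \<open>G s = n t P + d t Q\<close> and
  \<open>C (\<Phi> t)\<inverse> B\<^sub>u = n s P + d s Q\<close>. Its determinant is, up to sign, \<open>d s d t (h s - h t)\<close>, which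
  is nonzero, and the blocks of the reduced matrices are multiples of its solution.\<close>

section \<open>Blocks of stacked matrices and of their products\<close>

lemma pick_atLeastLessThan:
  assumes "i < b - a"
  shows "pick {a..<b} i = a + i"
proof -
  \<comment> \<open>Exactly \<open>i\<close> elements of the interval lie below
    \<open>a + i\<close>, and \<open>pick\<close> recovers an element of a set from the number of
    its smaller elements.\<close>
  have "{x \<in> {a..<b}. x < a + i} = {a..<a + i}" using assms by auto
  then show ?thesis using pick_card_in_set[of "a + i" "{a..<b}"] assms by simp
qed

lemma block_bound:
  fixes k p N a :: nat
  assumes "k < N" "a < p"
  shows "k * p + a < p * N"
proof -
  have "k * p + a < Suc k * p" using assms by simp
  also have "\<dots> \<le> N * p" using assms by (intro mult_le_mono1) simp
  finally show ?thesis by (simp add: mult.commute)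
qed

text \<open>\<open>submatrix\<close> takes its dimensions from the number of selected indices that
  are in range. The set here is the form \<open>simp\<close> gives it after unfolding a block, with
  \<open>(k + 1) * p\<close> turned into \<open>p + k * p\<close>. The range cuts nothing off,
  because \<open>k < N\<close> keeps the whole block inside.\<close>

lemma card_block_indices:
  fixes k p N :: nat
  assumes "k < N"
  shows "card {i. i < p * N \<and> k * p \<le> i \<and> i < p + k * p} = p"
proof -
  have "(k + 1) * p \<le> N * p" using assms by (intro mult_le_mono1) simp
  then have "{i. i < p * N \<and> k * p \<le> i \<and> i < p + k * p} = {k * p..<p + k * p}"
    by (auto simp: mult.commute)
  then show ?thesis by simp
qed

lemma row_block_eq_mat:
  assumes "X \<in> carrier_mat (p * N) q" "k < N"
  shows "row_block p X k = mat p q (\<lambda>(a, b). X $$ (k * p + a, b))"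
  using assms card_block_indices[OF assms(2)]
  by (auto simp: row_block_def submatrix_def pick_UNIV pick_atLeastLessThan)

lemma col_block_eq_mat:
  assumes "X \<in> carrier_mat q (m * J)" "j < J"
  shows "col_block m X j = mat q m (\<lambda>(a, b). X $$ (a, j * m + b))"
  using assms card_block_indices[OF assms(2)]
  by (auto simp: col_block_def submatrix_def pick_UNIV pick_atLeastLessThan)

lemma block_eq_mat:
  assumes "X \<in> carrier_mat (p * N) (m * J)" "k < N" "j < J"
  shows "block p m X k j = mat p m (\<lambda>(a, b). X $$ (k * p + a, j * m + b))"
  using assms card_block_indices[OF assms(2)] card_block_indices[OF assms(3)]
  by (auto simp: block_def submatrix_def pick_atLeastLessThan)

lemma block_row_carrier: "block_row n m J A \<in> carrier_mat n (m * J)"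
  by (simp add: block_row_def)

lemma block_col_carrier: "block_col p n N A \<in> carrier_mat (p * N) n"
  by (simp add: block_col_def)

lemma row_block_col_mult:
  assumes A: "A k \<in> carrier_mat p q" and B: "B \<in> carrier_mat q r" and k: "k < N"
  shows "row_block p (block_col p q N A * B) k = A k * B"
proof -
  have X: "block_col p q N A * B \<in> carrier_mat (p * N) r"
    by (rule mult_carrier_mat[OF block_col_carrier B])
  \<comment> \<open>For \<open>a < p\<close>, dividing \<open>k * p + a\<close> by \<open>p\<close>
    gives quotient \<open>k\<close> and remainder \<open>a\<close>, which undoes the encoding in
    \<open>block_col\<close>. An entry of the product depends on the left factor only through one
    such row.\<close>
  have "row (block_col p q N A) (k * p + a) = row (A k) a" if "a < p" for a
    using A that block_bound[OF k that] by (auto simp: block_col_def)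
  then show ?thesis
    unfolding row_block_eq_mat[OF X k] using A B block_bound[OF k]
    by (intro eq_matI) (auto simp: block_col_def)
qed

lemma col_block_row_mult:
  assumes B: "B \<in> carrier_mat r q" and A: "A j \<in> carrier_mat q m" and j: "j < J"
  shows "col_block m (B * block_row q m J A) j = B * A j"
proof -
  have X: "B * block_row q m J A \<in> carrier_mat r (m * J)"
    by (rule mult_carrier_mat[OF B block_row_carrier])
  have "col (block_row q m J A) (j * m + b) = col (A j) b" if "b < m" for b
    using A that block_bound[OF j that] by (auto simp: block_row_def)
  then show ?thesis
    unfolding col_block_eq_mat[OF X j] using A B block_bound[OF j]
    by (intro eq_matI) (auto simp: block_row_def)
qed

text \<open>Cutting rows first and columns second lets the two one-sided product rules be applied
  one after the other.\<close>

lemma block_eq_col_block_row_block: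
  assumes "X \<in> carrier_mat (p * N) (m * J)" "k < N" "j < J"
  shows "block p m X k j = col_block m (row_block p X k) j"
proof -
  have "row_block p X k \<in> carrier_mat p (m * J)"
    using assms by (simp add: row_block_eq_mat)
  from col_block_eq_mat[OF this] show ?thesis
    using assms block_bound[OF assms(3)]
    by (auto simp: block_eq_mat row_block_eq_mat intro!: eq_matI)
qed

lemma block_col_mult_row:
  assumes A: "A k \<in> carrier_mat p q" and M: "M \<in> carrier_mat q r"
    and B: "B j \<in> carrier_mat r m" and "k < N" "j < J"
  shows "block p m (block_col p q N A * M * block_row r m J B) k j = A k * M * B j"
proof -
  note C = block_col_carrier[of p q N A] and R = block_row_carrier[of r m J B]
  have "block p m (block_col p q N A * M * block_row r m J B) k j
      = col_block m (row_block p (block_col p q N A * (M * block_row r m J B)) k) j"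
    using assoc_mult_mat[OF C M R] C M R assms(4,5)
    by (simp add: block_eq_col_block_row_block[of _ p N m J])
  also have "\<dots> = col_block m (A k * M * block_row r m J B) j"
    using row_block_col_mult[where A = A, OF A mult_carrier_mat[OF M R] \<open>k < N\<close>] A M R by simp
  also have "\<dots> = A k * M * B j"
    using A M by (intro col_block_row_mult[where r = p] B \<open>j < J\<close>) simp
  finally show ?thesis .
qed

section \<open>Adjoints and inverses\<close>

lemma mat_adjoint_mat_adjoint:
  fixes A :: "'a :: conjugatable_field mat"
  shows "mat_adjoint (mat_adjoint A) = A"
  by (intro eq_matI) (auto simp: mat_adjoint_def mat_of_rows_index conjugate_vec_def)

lemma mat_inv:
  assumes "A \<in> carrier_mat n n" "invertible_mat A"
  shows mat_inv_carrier: "mat_inv A \<in> carrier_mat n n"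
    and mat_inv_right: "A * mat_inv A = 1\<^sub>m n"
    and mat_inv_left: "mat_inv A * A = 1\<^sub>m n"
proof -
  obtain B where B: "A * B = 1\<^sub>m (dim_row A)" "B * A = 1\<^sub>m (dim_row B)"
    using assms(2) unfolding invertible_mat_def inverts_mat_def by auto
  \<comment> \<open>Both products are identity matrices, hence square, and this forces the shape of
    \<open>B\<close>.\<close>
  have "dim_row B = n" "dim_col B = n"
    using B assms(1) by (metis carrier_matD(1,2) index_mult_mat(2,3) index_one_mat(2,3))+
  then have "A \<in> Units (ring_mat TYPE(complex) n ())"
    using B assms(1) by (auto simp: Units_def ring_mat_simps intro!: bexI[of _ B])
  \<comment> \<open>\<open>mat_inverse\<close> yields \<open>None\<close> only for non-units of the
    matrix ring, so the \<open>the\<close> in \<open>mat_inv\<close> meets a genuine value.\<close>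
  then obtain C where "mat_inverse A = Some C"
    using mat_inverse(1)[OF assms(1), where b = "()"] by (cases "mat_inverse A") auto
  with mat_inverse(2)[OF assms(1) this]
  show "mat_inv A \<in> carrier_mat n n" "A * mat_inv A = 1\<^sub>m n" "mat_inv A * A = 1\<^sub>m n"
    by (simp_all add: mat_inv_def)
qed

section \<open>Linearity in the two coefficient matrices, and the resulting linear system\<close>

lemma Phi_mat_carrier:
  assumes "M \<in> carrier_mat n n" "K \<in> carrier_mat n n"
  shows "Phi_mat f g M K s \<in> carrier_mat n n"
  using assms by (simp add: Phi_mat_def damping_mat_def)

lemma Phi_mat_eq:
  assumes "M \<in> carrier_mat n n" "K \<in> carrier_mat n n"
  shows "Phi_mat f g M K s = n_fun f s \<cdot>\<^sub>m cmat M + d_fun g s \<cdot>\<^sub>m cmat K"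
  using assms
  by (intro eq_matI) (auto simp: Phi_mat_def damping_mat_def n_fun_def d_fun_def algebra_simps)

lemma smult_smult_mat:
  fixes A :: "'a :: semigroup_mult mat"
  shows "a \<cdot>\<^sub>m (b \<cdot>\<^sub>m A) = (a * b) \<cdot>\<^sub>m A"
  by (intro eq_matI) (auto simp: mult.assoc)

lemma mult_lincomb_mult:
  fixes A B :: "'a :: comm_ring_1 mat"
  assumes "L \<in> carrier_mat p n" "A \<in> carrier_mat n n" "B \<in> carrier_mat n n" "R \<in> carrier_mat n m"
  shows "L * (a \<cdot>\<^sub>m A + b \<cdot>\<^sub>m B) * R = a \<cdot>\<^sub>m (L * A * R) + b \<cdot>\<^sub>m (L * B * R)"
proof -
  have "L * (a \<cdot>\<^sub>m A + b \<cdot>\<^sub>m B) = a \<cdot>\<^sub>m (L * A) + b \<cdot>\<^sub>m (L * B)"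
    using assms by (simp add: mult_add_distrib_mat[of _ p n _ n] mult_smult_distrib[of _ p n _ n])
  also have "\<dots> * R = a \<cdot>\<^sub>m (L * A * R) + b \<cdot>\<^sub>m (L * B * R)"
    using assms by (simp add: add_mult_distrib_mat[of _ p n _ _ m] mult_smult_assoc_mat[of _ p n _ m]
        del: assoc_mult_mat)
  finally show ?thesis .
qed

text \<open>Cramer's rule, entry by entry, with determinant \<open>x\<^sub>1 * y\<^sub>2 - x\<^sub>2 * y\<^sub>1\<close> written
  in terms of the quotients \<open>x\<^sub>i / y\<^sub>i\<close>.\<close>
lemma solve_mat_lincomb:
  fixes P Q :: "complex mat"
  assumes "P \<in> carrier_mat p m" "Q \<in> carrier_mat p m"
    and "y\<^sub>1 \<noteq> 0" "y\<^sub>2 \<noteq> 0" "x\<^sub>1 / y\<^sub>1 \<noteq> x\<^sub>2 / y\<^sub>2"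
    and S: "S = x\<^sub>2 \<cdot>\<^sub>m P + y\<^sub>2 \<cdot>\<^sub>m Q" and T: "T = x\<^sub>1 \<cdot>\<^sub>m P + y\<^sub>1 \<cdot>\<^sub>m Q"
  shows "c \<cdot>\<^sub>m P = (- (c / (y\<^sub>1 * y\<^sub>2))) \<cdot>\<^sub>m ((1 / (x\<^sub>1 / y\<^sub>1 - x\<^sub>2 / y\<^sub>2)) \<cdot>\<^sub>m (y\<^sub>1 \<cdot>\<^sub>m S - y\<^sub>2 \<cdot>\<^sub>m T))"
    and "c \<cdot>\<^sub>m Q = (c / (y\<^sub>1 * y\<^sub>2)) \<cdot>\<^sub>m ((1 / (x\<^sub>1 / y\<^sub>1 - x\<^sub>2 / y\<^sub>2)) \<cdot>\<^sub>m (x\<^sub>1 \<cdot>\<^sub>m S - x\<^sub>2 \<cdot>\<^sub>m T))"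
proof -
  define \<Delta> where "\<Delta> = x\<^sub>1 * y\<^sub>2 - x\<^sub>2 * y\<^sub>1"
  have \<Delta>: "\<Delta> \<noteq> 0" using assms(3-5) by (auto simp: \<Delta>_def field_simps)
  have q: "x\<^sub>1 / y\<^sub>1 - x\<^sub>2 / y\<^sub>2 = \<Delta> / (y\<^sub>1 * y\<^sub>2)"
    using assms(3,4) by (simp add: \<Delta>_def field_simps)
  \<comment> \<open>The first combination eliminates \<open>Q\<close>, the second eliminates
    \<open>P\<close>; what survives is the determinant up to sign. By \<open>q\<close> the
    prefactors then cancel it together with \<open>y\<^sub>1 * y\<^sub>2\<close>, leaving
    \<open>c\<close>.\<close>
  have P: "y\<^sub>1 \<cdot>\<^sub>m S - y\<^sub>2 \<cdot>\<^sub>m T = (- \<Delta>) \<cdot>\<^sub>m P" and Q: "x\<^sub>1 \<cdot>\<^sub>m S - x\<^sub>2 \<cdot>\<^sub>m T = \<Delta> \<cdot>\<^sub>m Q"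
    using assms(1,2) unfolding S T \<Delta>_def by (auto intro!: eq_matI simp: algebra_simps)
  show "c \<cdot>\<^sub>m P = (- (c / (y\<^sub>1 * y\<^sub>2))) \<cdot>\<^sub>m ((1 / (x\<^sub>1 / y\<^sub>1 - x\<^sub>2 / y\<^sub>2)) \<cdot>\<^sub>m (y\<^sub>1 \<cdot>\<^sub>m S - y\<^sub>2 \<cdot>\<^sub>m T))"
    "c \<cdot>\<^sub>m Q = (c / (y\<^sub>1 * y\<^sub>2)) \<cdot>\<^sub>m ((1 / (x\<^sub>1 / y\<^sub>1 - x\<^sub>2 / y\<^sub>2)) \<cdot>\<^sub>m (x\<^sub>1 \<cdot>\<^sub>m S - x\<^sub>2 \<cdot>\<^sub>m T))"
    unfolding P Q q using \<Delta> assms(3,4) by (auto intro!: eq_matI)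
qed

section \<open>The blocks of the reduced matrices\<close>

theorem theorem1:
  fixes n m p N J :: nat
    and M K B\<^sub>u C\<^sub>p C\<^sub>v :: "real mat"
    and f g :: "complex \<Rightarrow> complex"
    and \<theta> \<phi> \<zeta> \<rho> :: "nat \<Rightarrow> real"
  defines "\<Phi> \<equiv> Phi_mat f g M K"
    and "d \<equiv> d_fun g"
    and "\<nu> \<equiv> n_fun f"
    and "h \<equiv> h_fun f g"
  defines "G \<equiv> transfer_fun \<Phi> B\<^sub>u C\<^sub>p C\<^sub>v"
    and "G\<^sub>p \<equiv> transfer_pos \<Phi> B\<^sub>u C\<^sub>p"
    and "G\<^sub>v \<equiv> transfer_vel \<Phi> B\<^sub>u C\<^sub>v"
  defines "R\<^sub>p \<equiv> right_factor \<Phi> B\<^sub>u J \<rho> \<zeta>"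
    and "L\<^sub>v \<equiv> left_factor \<Phi> C\<^sub>p C\<^sub>v N \<phi> \<theta>"
  defines "Mr \<equiv> mat_adjoint L\<^sub>v * cmat M * R\<^sub>p"
    and "Kr \<equiv> mat_adjoint L\<^sub>v * cmat K * R\<^sub>p"
    and "Br \<equiv> mat_adjoint L\<^sub>v * cmat B\<^sub>u"
    and "Cpr \<equiv> cmat C\<^sub>p * R\<^sub>p"
    and "Cvr \<equiv> cmat C\<^sub>v * R\<^sub>p"
  assumes "M \<in> carrier_mat n n" and "K \<in> carrier_mat n n"
    and "B\<^sub>u \<in> carrier_mat n m"
    and "C\<^sub>p \<in> carrier_mat p n" and "C\<^sub>v \<in> carrier_mat p n"
    and "\<And>j. j < J \<Longrightarrow> \<zeta> j \<noteq> 0"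
    and "\<And>k. k < N \<Longrightarrow> d (\<i> * \<theta> k) \<noteq> 0"
    and "\<And>j. j < J \<Longrightarrow> d (\<i> * \<zeta> j) \<noteq> 0"
    and "\<And>k j. k < N \<Longrightarrow> j < J \<Longrightarrow> h (\<i> * \<theta> k) \<noteq> h (\<i> * \<zeta> j)"
    and "\<And>j. j < J \<Longrightarrow> invertible_mat (\<Phi> (\<i> * \<zeta> j))"
    and "\<And>k. k < N \<Longrightarrow> invertible_mat (\<Phi> (\<i> * \<theta> k))"
  shows
    "(\<forall>k<N. \<forall>j<J. block p m Mr k j =
        (- (complex_of_real (\<phi> k * \<rho> j) / (d (\<i> * \<theta> k) * d (\<i> * \<zeta> j)))) \<cdot>\<^sub>m
        ((1 / (h (\<i> * \<theta> k) - h (\<i> * \<zeta> j))) \<cdot>\<^sub>m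
          (d (\<i> * \<theta> k) \<cdot>\<^sub>m G (\<i> * \<theta> k)
            - d (\<i> * \<zeta> j) \<cdot>\<^sub>m
                (G\<^sub>p (\<i> * \<zeta> j) + complex_of_real (\<theta> k / \<zeta> j) \<cdot>\<^sub>m G\<^sub>v (\<i> * \<zeta> j)))))
     \<and> (\<forall>k<N. \<forall>j<J. block p m Kr k j =
        (complex_of_real (\<phi> k * \<rho> j) / (d (\<i> * \<theta> k) * d (\<i> * \<zeta> j))) \<cdot>\<^sub>m
        ((1 / (h (\<i> * \<theta> k) - h (\<i> * \<zeta> j))) \<cdot>\<^sub>m
          (\<nu> (\<i> * \<theta> k) \<cdot>\<^sub>m G (\<i> * \<theta> k)
            - \<nu> (\<i> * \<zeta> j) \<cdot>\<^sub>m
                (G\<^sub>p (\<i> * \<zeta> j) + complex_of_real (\<theta> k / \<zeta> j) \<cdot>\<^sub>m G\<^sub>v (\<i> * \<zeta> j)))))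
     \<and> (\<forall>k<N. row_block p Br k = complex_of_real (\<phi> k) \<cdot>\<^sub>m G (\<i> * \<theta> k))
     \<and> (\<forall>j<J. col_block m Cpr j = complex_of_real (\<rho> j) \<cdot>\<^sub>m G\<^sub>p (\<i> * \<zeta> j))
     \<and> (\<forall>j<J. col_block m Cvr j =
          (complex_of_real (\<rho> j) / (\<i> * \<zeta> j)) \<cdot>\<^sub>m G\<^sub>v (\<i> * \<zeta> j))"
proof -
  note M = assms(15) and K = assms(16) and B = assms(17) and Cp = assms(18) and Cv = assms(19)
    and \<zeta> = assms(20) and d\<theta> = assms(21) and d\<zeta> = assms(22) and h = assms(23)
    and inv\<zeta> = assms(24) and inv\<theta> = assms(25)
  define X where "X k = mat_inv (\<Phi> (\<i> * \<theta> k))" for k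
  define Y where "Y j = mat_inv (\<Phi> (\<i> * \<zeta> j))" for j
  define C where "C k = cmat C\<^sub>p + (\<i> * \<theta> k) \<cdot>\<^sub>m cmat C\<^sub>v" for k
  define l where "l k = complex_of_real (\<phi> k) \<cdot>\<^sub>m (C k * X k)" for k
  define r where "r j = complex_of_real (\<rho> j) \<cdot>\<^sub>m (Y j * cmat B\<^sub>u)" for j
  have \<Phi>: "\<Phi> s \<in> carrier_mat n n" for s
    unfolding \<Phi>_def by (rule Phi_mat_carrier[OF M K])
  have \<Phi>_eq: "\<Phi> s = \<nu> s \<cdot>\<^sub>m cmat M + d s \<cdot>\<^sub>m cmat K" for s
    unfolding \<Phi>_def \<nu>_def d_def by (rule Phi_mat_eq[OF M K])
  have cM: "cmat M \<in> carrier_mat n n" and cK: "cmat K \<in> carrier_mat n n"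
    and cB: "cmat B\<^sub>u \<in> carrier_mat n m" and cCp: "cmat C\<^sub>p \<in> carrier_mat p n"
    and cCv: "cmat C\<^sub>v \<in> carrier_mat p n"
    using M K B Cp Cv by auto
  have C: "C k \<in> carrier_mat p n" for k unfolding C_def using cCp cCv by simp
  \<comment> \<open>\<open>X k\<close> will stand to the left of the inserted matrix and
    \<open>Y j\<close> to its right, so the former is used as a left inverse and the latter as a
    right inverse.\<close>
  have X: "X k \<in> carrier_mat n n" and X\<Phi>: "X k * \<Phi> (\<i> * \<theta> k) = 1\<^sub>m n" if "k < N" for k
    unfolding X_def by (rule mat_inv_carrier mat_inv_left, rule \<Phi>, rule inv\<theta>, rule that)+
  have Y: "Y j \<in> carrier_mat n n" and Y\<Phi>: "\<Phi> (\<i> * \<zeta> j) * Y j = 1\<^sub>m n" if "j < J" for j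
    unfolding Y_def by (rule mat_inv_carrier mat_inv_right, rule \<Phi>, rule inv\<zeta>, rule that)+
  have l: "l k \<in> carrier_mat p n" if "k < N" for k unfolding l_def using mult_carrier_mat[OF C X[OF that]] by simp
  have r: "r j \<in> carrier_mat n m" if "j < J" for j unfolding r_def using mult_carrier_mat[OF Y[OF that] cB] by simp
  \<comment> \<open>The left factor is itself an adjoint, so taking the adjoint again returns the
    stacked matrix.\<close>
  have L: "mat_adjoint L\<^sub>v = block_col p n N l"
    unfolding L\<^sub>v_def left_factor_def mat_adjoint_mat_adjoint l_def C_def X_def using Cp by simp
  have R: "R\<^sub>p = block_row n m J r"
    unfolding R\<^sub>p_def right_factor_def r_def Y_def using B by simp
  have G: "G (\<i> * \<theta> k) = C k * X k * cmat B\<^sub>u" for k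
    unfolding G_def transfer_fun_def C_def X_def ..
  have Gp: "G\<^sub>p (\<i> * \<zeta> j) = cmat C\<^sub>p * (Y j * cmat B\<^sub>u)" if "j < J" for j
    unfolding G\<^sub>p_def transfer_pos_def Y_def[symmetric] using cCp Y[OF that] cB by simp
  have Gv: "G\<^sub>v (\<i> * \<zeta> j) = (\<i> * \<zeta> j) \<cdot>\<^sub>m (cmat C\<^sub>v * (Y j * cmat B\<^sub>u))" if "j < J" for j
    unfolding G\<^sub>v_def transfer_vel_def Y_def[symmetric] using cCv Y[OF that] cB by simp
  \<comment> \<open>\<open>G\<^sub>v\<close> carries its node \<open>\<i> * \<zeta> j\<close> as a
    factor. The ratio \<open>\<theta> k / \<zeta> j\<close> exchanges it for
    \<open>\<i> * \<theta> k\<close>, so the output matrix belongs to the left node while the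
    inverse stays at the right node.\<close>
  have mixed: "G\<^sub>p (\<i> * \<zeta> j) + complex_of_real (\<theta> k / \<zeta> j) \<cdot>\<^sub>m G\<^sub>v (\<i> * \<zeta> j) = C k * (Y j * cmat B\<^sub>u)"
    if "j < J" for k j
  proof -
    have YB: "Y j * cmat B\<^sub>u \<in> carrier_mat n m" using Y[OF that] cB by simp
    have "C k * (Y j * cmat B\<^sub>u)
        = cmat C\<^sub>p * (Y j * cmat B\<^sub>u) + (\<i> * \<theta> k) \<cdot>\<^sub>m (cmat C\<^sub>v * (Y j * cmat B\<^sub>u))"
      unfolding C_def using cCp cCv YB
      by (simp add: add_mult_distrib_mat[of _ p n _ _ m] mult_smult_assoc_mat[of _ p n _ m])
    also have "(\<i> * \<theta> k) \<cdot>\<^sub>m (cmat C\<^sub>v * (Y j * cmat B\<^sub>u))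
        = complex_of_real (\<theta> k / \<zeta> j) \<cdot>\<^sub>m G\<^sub>v (\<i> * \<zeta> j)"
      unfolding Gv[OF that] using \<zeta>[OF that] by (intro eq_matI) auto
    finally show ?thesis unfolding Gp[OF that] ..
  qed
  \<comment> \<open>Kept general in \<open>A\<close> so that it serves both the mass and the
    stiffness matrix.\<close>
  have block: "block p m (mat_adjoint L\<^sub>v * A * R\<^sub>p) k j
      = complex_of_real (\<phi> k * \<rho> j) \<cdot>\<^sub>m (C k * X k * A * (Y j * cmat B\<^sub>u))"
    if "k < N" "j < J" "A \<in> carrier_mat n n" for k j A
  proof -
    note CX = mult_carrier_mat[OF C X[OF that(1)]]
    show ?thesis
      unfolding L R block_col_mult_row[where A = l and B = r, OF l[OF that(1)] that(3) r[OF that(2)] that(1,2)]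
      unfolding l_def r_def
      using CX mult_carrier_mat[OF CX that(3)] mult_carrier_mat[OF Y[OF that(2)] cB] that(3)
      by (simp add: mult_smult_assoc_mat[of _ p n _ n] mult_smult_assoc_mat[of _ p n _ m]
          mult_smult_distrib[of _ p n _ m] ac_simps smult_smult_mat del: assoc_mult_mat)
  qed
  have "block p m Mr k j =
        (- (complex_of_real (\<phi> k * \<rho> j) / (d (\<i> * \<theta> k) * d (\<i> * \<zeta> j)))) \<cdot>\<^sub>m
        ((1 / (h (\<i> * \<theta> k) - h (\<i> * \<zeta> j))) \<cdot>\<^sub>m
          (d (\<i> * \<theta> k) \<cdot>\<^sub>m G (\<i> * \<theta> k)
            - d (\<i> * \<zeta> j) \<cdot>\<^sub>m
                (G\<^sub>p (\<i> * \<zeta> j) + complex_of_real (\<theta> k / \<zeta> j) \<cdot>\<^sub>m G\<^sub>v (\<i> * \<zeta> j))))" (is ?Meq)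
    and "block p m Kr k j =
        (complex_of_real (\<phi> k * \<rho> j) / (d (\<i> * \<theta> k) * d (\<i> * \<zeta> j))) \<cdot>\<^sub>m
        ((1 / (h (\<i> * \<theta> k) - h (\<i> * \<zeta> j))) \<cdot>\<^sub>m
          (\<nu> (\<i> * \<theta> k) \<cdot>\<^sub>m G (\<i> * \<theta> k)
            - \<nu> (\<i> * \<zeta> j) \<cdot>\<^sub>m
                (G\<^sub>p (\<i> * \<zeta> j) + complex_of_real (\<theta> k / \<zeta> j) \<cdot>\<^sub>m G\<^sub>v (\<i> * \<zeta> j))))" (is ?Keq)
    if k: "k < N" and j: "j < J" for k j
  proof -
    let ?s = "\<i> * complex_of_real (\<theta> k)" and ?t = "\<i> * complex_of_real (\<zeta> j)"
    define P where "P = C k * X k * cmat M * (Y j * cmat B\<^sub>u)"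
    define Q where "Q = C k * X k * cmat K * (Y j * cmat B\<^sub>u)"
    note CX = mult_carrier_mat[OF C X[OF k]] and YB = mult_carrier_mat[OF Y[OF j] cB]
    have P: "P \<in> carrier_mat p m" and Q: "Q \<in> carrier_mat p m"
      unfolding P_def Q_def by (rule mult_carrier_mat mult_carrier_mat[OF CX] cM cK YB)+
    have insert: "C k * X k * \<Phi> s * (Y j * cmat B\<^sub>u) = \<nu> s \<cdot>\<^sub>m P + d s \<cdot>\<^sub>m Q" for s
      unfolding \<Phi>_eq P_def Q_def by (rule mult_lincomb_mult[OF CX cM cK YB])
    \<comment> \<open>At the right node the inserted matrix cancels against \<open>Y j\<close>,
      leaving the full transfer function at the left node.\<close>
    have "C k * X k * \<Phi> ?t * (Y j * cmat B\<^sub>u) = C k * X k * (\<Phi> ?t * (Y j * cmat B\<^sub>u))"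
      by (rule assoc_mult_mat[OF CX \<Phi> YB])
    also have "\<dots> = C k * X k * (\<Phi> ?t * Y j * cmat B\<^sub>u)"
      by (simp only: assoc_mult_mat[OF \<Phi> Y[OF j] cB])
    also have "\<dots> = G ?s" unfolding Y\<Phi>[OF j] G using cB by simp
    finally have eq1: "G ?s = \<nu> ?t \<cdot>\<^sub>m P + d ?t \<cdot>\<^sub>m Q" unfolding insert ..
    \<comment> \<open>At the left node it cancels against \<open>X k\<close> instead, leaving the
      mixed expression from \<open>mixed\<close>.\<close>
    have "C k * X k * \<Phi> ?s * (Y j * cmat B\<^sub>u) = C k * (X k * \<Phi> ?s) * (Y j * cmat B\<^sub>u)"
      by (simp only: assoc_mult_mat[OF C X[OF k] \<Phi>])
    also have "\<dots> = C k * (Y j * cmat B\<^sub>u)"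
      unfolding X\<Phi>[OF k] by (simp only: right_mult_one_mat[OF C])
    finally have eq2: "C k * (Y j * cmat B\<^sub>u) = \<nu> ?s \<cdot>\<^sub>m P + d ?s \<cdot>\<^sub>m Q" unfolding insert ..
    have h_eq: "h s = \<nu> s / d s" for s unfolding h_def \<nu>_def d_def h_fun_def ..
    \<comment> \<open>Index 1 of the linear system is the left node and index 2 the right one, with
      \<open>x\<close> the value of \<open>\<nu>\<close> and \<open>y\<close> that of
      \<open>d\<close>. The scalar \<open>c\<close> stays free and becomes the product of the weight
      roots \<open>\<phi> k\<close> and \<open>\<rho> j\<close>.\<close>
    note solution = solve_mat_lincomb[OF P Q d\<theta>[OF k] d\<zeta>[OF j] h[OF k j, unfolded h_eq] eq1 eq2]
    show ?Meq unfolding Mr_def block[OF k j cM] h_eq mixed[OF j] P_def[symmetric]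
      by (rule solution(1))
    show ?Keq unfolding Kr_def block[OF k j cK] h_eq mixed[OF j] Q_def[symmetric]
      by (rule solution(2))
  qed
  moreover have "row_block p Br k = complex_of_real (\<phi> k) \<cdot>\<^sub>m G (\<i> * \<theta> k)" if "k < N" for k
    unfolding Br_def L row_block_col_mult[where A = l, OF l[OF that] cB that] G unfolding l_def
    by (rule mult_smult_assoc_mat[OF mult_carrier_mat[OF C X[OF that]] cB])
  moreover have "col_block m Cpr j = complex_of_real (\<rho> j) \<cdot>\<^sub>m G\<^sub>p (\<i> * \<zeta> j)" if "j < J" for j
    unfolding Cpr_def R col_block_row_mult[where A = r, OF cCp r[OF that] that] Gp[OF that] unfolding r_def
    by (rule mult_smult_distrib[OF cCp mult_carrier_mat[OF Y[OF that] cB]])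
  moreover have "col_block m Cvr j = (complex_of_real (\<rho> j) / (\<i> * \<zeta> j)) \<cdot>\<^sub>m G\<^sub>v (\<i> * \<zeta> j)"
    if "j < J" for j
  proof -
    have "col_block m Cvr j = complex_of_real (\<rho> j) \<cdot>\<^sub>m (cmat C\<^sub>v * (Y j * cmat B\<^sub>u))"
      unfolding Cvr_def R col_block_row_mult[where A = r, OF cCv r[OF that] that] unfolding r_def
      by (rule mult_smult_distrib[OF cCv mult_carrier_mat[OF Y[OF that] cB]])
    \<comment> \<open>Division by the nonzero node removes the factor
      \<open>\<i> * \<zeta> j\<close> built into \<open>G\<^sub>v\<close>.\<close>
    then show ?thesis unfolding Gv[OF that] using \<zeta>[OF that] by (auto intro!: eq_matI)
  qed
  ultimately show ?thesis by blast
qed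

end
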